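(* Let $A_{(-)}$ be a port-decreasing, time-increasing, commutative $N$-local rule, with $N$ an extensive, monotonous and private neighbourhood scheme. Then for every graph $G$, the space-time diagram $\mathcal{M}_A(G)$ is consistent, i.e. any two graphs $H,H'\in\mathcal{M}_A(G)$ are consistent.
   Context: Graphs are directed acyclic port graphs whose vertices have names $t.x$ with $t\in\mathbb{Z}$ a time tag and $x$ a position (each position appears at most once per graph); $\mathrm{I}_G$ denotes internal vertices, $\mathrm{E}_G$ edges of the form $(u\!:\!a,v\!:\!b)$ between ports, $\sigma_G$ internal states, $G_v$ the induced subgraph with internal vertex set $\{v\}$, and $\mathrm{Past}(G)$ the vertices without incoming edges. A neighbourhood scheme $N$ maps a set of positions $\omega$ and a graph $G$ to a set $N_\omega(G)$ of positions reachable from $\omega$. A local rule $A_{(-)}$ associates to each position $x$ an operator $A_x$ on graphs which is $N$-local: if $x$ is the position of a vertex in $\mathrm{Past}(G)$ then $A_xG=(A_xG_{N_x})\sqcup G_{\overline{N_x}}$, and $A_xG=G$ otherwise. A sequence $\omega$ of positions is valid in $G$ if each letter, when applied, is the position of a past vertex of the current graph; $A_{yx}$ means $A_yA_x$. The space-time diagram is $\mathcal{M}_A(G)=\{A_\omega G\mid \omega\text{ valid in }G\}$. Two graphs $G,H$ are consistent iff for every $v\in\mathrm{I}_G\cap\mathrm{I}_H$, if the set of incoming ports of $v$ (i.e. $\{b\mid (u\!:\!a,v\!:\!b)\in\mathrm{E}_G\}$) is the same in $G$ and in $H$, then $G_v=H_v$. Time-increasing: time tags never decrease, and strictly increase at the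 updated position. Commutative: $A_xA_yG=A_yA_xG$ for $x,y$ positions of past vertices of $G$. Extensive: $G_{N_\omega(G)}\sqsubseteq H\sqsubseteq G$ implies $N_\omega(G)=N_\omega(H)$. Monotonous: for every valid $\omega=\gamma\beta\alpha$, $N_\beta(A_\alpha G)\subseteq N_\omega(G)$. Private: for disjoint valid sequences $\omega,\omega'$, the interior positions of $N_{\omega'}(G)$ do not meet $N_\omega(G)$. Port decreasing: whenever $A_x$ modifies the neighbourhood of a vertex $u$, the set of incoming ports of $u$ coming from the interior of $N_x(G)$ strictly decreases for a fixed order on sets of ports that is inclusive ($A\supseteq A'\Rightarrow A\ge A'$) and monotonous ($A\cap B=\emptyset,\ A\ge A',\ B>B'\Rightarrow A\cup B>A'\uplus B'$).
   Formalization: Port decreasing is strengthened: after applying A_x, the incoming ports of u that are compared also include those of newly created edges from vertices outside the interior of N_x(G); counting only interior sources makes the claim false. *)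

theory Defs
  imports Main
begin

text \<open>A vertex name \<open>t.x\<close> is the pair of its time tag and its position.\<close>

type_synonym 'x vertex = "int \<times> 'x"
type_synonym ('x, 'p) edge = "('x vertex \<times> 'p) \<times> ('x vertex \<times> 'p)"

abbreviation time :: "'x vertex \<Rightarrow> int" where "time \<equiv> fst"
abbreviation pos :: "'x vertex \<Rightarrow> 'x" where "pos \<equiv> snd"

text \<open>
  Internal vertices are those that carry a state. Border vertices carry none; they occur only as
  the other endpoint of an edge of an internal vertex, so that they are determined by the edges.
\<close>

record ('x, 'p, 's) pgraph =
  edges :: "('x, 'p) edge set"
  state :: "'x vertex \<Rightarrow> 's option"

definition internal :: "('x, 'p, 's) pgraph \<Rightarrow> 'x vertex set" where
  "internal G = dom (state G)"

definition arcs :: "('x, 'p, 's) pgraph \<Rightarrow> 'x vertex rel" where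
  "arcs G = {(u, v). \<exists>a b. ((u, a), (v, b)) \<in> edges G}"

definition verts :: "('x, 'p, 's) pgraph \<Rightarrow> 'x vertex set" where
  "verts G = internal G \<union> Field (arcs G)"

definition is_graph :: "('x, 'p, 's) pgraph \<Rightarrow> bool" where
  "is_graph G \<longleftrightarrow>
     inj_on pos (verts G) \<and>
     acyclic (arcs G) \<and>
     (\<forall>(u, v) \<in> arcs G. u \<in> internal G \<or> v \<in> internal G) \<and>
     (\<forall>e \<in> edges G. \<forall>f \<in> edges G. {fst e, snd e} \<inter> {fst f, snd f} \<noteq> {} \<longrightarrow> e = f)"

text \<open>
  Only internal vertices can be in the past: the missing incoming edges of a border vertex may
  have been cut off.
\<close>

definition past :: "('x, 'p, 's) pgraph \<Rightarrow> 'x vertex set" where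
  "past G = {v \<in> internal G. v \<notin> Range (arcs G)}"

definition in_ports :: "('x, 'p, 's) pgraph \<Rightarrow> 'x vertex \<Rightarrow> 'p set" where
  "in_ports G v = {b. \<exists>u a. ((u, a), (v, b)) \<in> edges G}"

definition induced :: "('x, 'p, 's) pgraph \<Rightarrow> 'x vertex set \<Rightarrow> ('x, 'p, 's) pgraph" where
  "induced G U =
     \<lparr>edges = {((u, a), (v, b)) | u a v b.
                 ((u, a), (v, b)) \<in> edges G \<and> (u \<in> internal G \<inter> U \<or> v \<in> internal G \<inter> U)},
      state = state G |` U\<rparr>"

definition at_pos :: "('x, 'p, 's) pgraph \<Rightarrow> 'x set \<Rightarrow> ('x, 'p, 's) pgraph" where
  "at_pos G X = induced G {v. pos v \<in> X}"

definition induced_subgraph :: "('x, 'p, 's) pgraph \<Rightarrow> ('x, 'p, 's) pgraph \<Rightarrow> bool"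
    (infix "\<sqsubseteq>" 50) where
  "H \<sqsubseteq> G \<longleftrightarrow> (\<exists>U. H = induced G U)"

definition consistent :: "('x, 'p, 's) pgraph \<Rightarrow> ('x, 'p, 's) pgraph \<Rightarrow> bool" where
  "consistent G H \<longleftrightarrow>
     (\<forall>v \<in> internal G \<inter> internal H.
        in_ports G v = in_ports H v \<longrightarrow> induced G {v} = induced H {v})"

text \<open>
  The disjoint union glues two graphs along their borders, and is the inverse of splitting a graph
  into two complementary induced subgraphs. It is defined when the two graphs share no internal
  vertex and contain the same edges between internal vertices of the one and of the other
  (and when the result is a graph).
\<close>

definition glueable :: "('x, 'p, 's) pgraph \<Rightarrow> ('x, 'p, 's) pgraph \<Rightarrow> bool" where
  "glueable G H \<longleftrightarrow>
     internal G \<inter> internal H = {} \<and>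
     (\<forall>((u, a), (v, b)) \<in> edges G. u \<in> internal H \<or> v \<in> internal H \<longrightarrow> ((u, a), (v, b)) \<in> edges H) \<and>
     (\<forall>((u, a), (v, b)) \<in> edges H. u \<in> internal G \<or> v \<in> internal G \<longrightarrow> ((u, a), (v, b)) \<in> edges G)"

definition disjoint_union ::
    "('x, 'p, 's) pgraph \<Rightarrow> ('x, 'p, 's) pgraph \<Rightarrow> ('x, 'p, 's) pgraph"  (infixl "\<squnion>" 65) where
  "G \<squnion> H = \<lparr>edges = edges G \<union> edges H, state = state G ++ state H\<rparr>"

type_synonym ('x, 'p, 's) scheme = "'x set \<Rightarrow> ('x, 'p, 's) pgraph \<Rightarrow> 'x set"
type_synonym ('x, 'p, 's) rule = "'x \<Rightarrow> ('x, 'p, 's) pgraph \<Rightarrow> ('x, 'p, 's) pgraph"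

definition reachable :: "'x set \<Rightarrow> ('x, 'p, 's) pgraph \<Rightarrow> 'x set" where
  "reachable X G = {pos v | v. v \<in> internal G \<and> (\<exists>u \<in> verts G. pos u \<in> X \<and> (u, v) \<in> (arcs G)\<^sup>*)}"

definition neighbourhood_scheme :: "('x, 'p, 's) scheme \<Rightarrow> bool" where
  "neighbourhood_scheme N \<longleftrightarrow> (\<forall>G X. is_graph G \<longrightarrow> N X G \<subseteq> reachable X G)"

definition local_rule :: "('x, 'p, 's) scheme \<Rightarrow> ('x, 'p, 's) rule \<Rightarrow> bool" where
  "local_rule N A \<longleftrightarrow>
     (\<forall>x G. is_graph G \<longrightarrow>
        is_graph (A x G) \<and>
        (x \<in> pos ` past G \<longrightarrow>
           glueable (A x (at_pos G (N {x} G))) (at_pos G (- N {x} G)) \<and>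
           A x G = A x (at_pos G (N {x} G)) \<squnion> at_pos G (- N {x} G)) \<and>
        (x \<notin> pos ` past G \<longrightarrow> A x G = G))"

text \<open>
  Sequences of positions are read from right to left: \<open>A\<^bsub>yx\<^esub>\<close> is \<open>foldr A [y, x]\<close>.
\<close>

fun valid :: "('x, 'p, 's) rule \<Rightarrow> 'x list \<Rightarrow> ('x, 'p, 's) pgraph \<Rightarrow> bool" where
  "valid A [] G \<longleftrightarrow> True"
| "valid A (x # \<omega>) G \<longleftrightarrow> valid A \<omega> G \<and> x \<in> pos ` past (foldr A \<omega> G)"

definition space_time :: "('x, 'p, 's) rule \<Rightarrow> ('x, 'p, 's) pgraph \<Rightarrow> ('x, 'p, 's) pgraph set" where
  "space_time A G = {foldr A \<omega> G | \<omega>. valid A \<omega> G}"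

definition time_increasing :: "('x, 'p, 's) rule \<Rightarrow> bool" where
  "time_increasing A \<longleftrightarrow>
     (\<forall>x G. is_graph G \<and> x \<in> pos ` past G \<longrightarrow>
        (\<forall>v \<in> verts G. \<forall>w \<in> verts (A x G). pos v = pos w \<longrightarrow>
           time v \<le> time w \<and> (pos v = x \<longrightarrow> time v < time w)))"

definition commutative :: "('x, 'p, 's) rule \<Rightarrow> bool" where
  "commutative A \<longleftrightarrow>
     (\<forall>G x y. is_graph G \<and> x \<in> pos ` past G \<and> y \<in> pos ` past G \<longrightarrow> A x (A y G) = A y (A x G))"

definition extensive :: "('x, 'p, 's) scheme \<Rightarrow> bool" where
  "extensive N \<longleftrightarrow>
     (\<forall>G H X. is_graph G \<and> is_graph H \<and> at_pos G (N X G) \<sqsubseteq> H \<and> H \<sqsubseteq> G \<longrightarrow> N X G = N X H)"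

definition monotonous :: "('x, 'p, 's) rule \<Rightarrow> ('x, 'p, 's) scheme \<Rightarrow> bool" where
  "monotonous A N \<longleftrightarrow>
     (\<forall>G \<alpha> \<beta> \<gamma>. is_graph G \<and> valid A (\<gamma> @ \<beta> @ \<alpha>) G \<longrightarrow>
        N (set \<beta>) (foldr A \<alpha> G) \<subseteq> N (set (\<gamma> @ \<beta> @ \<alpha>)) G)"

text \<open>
  The interior of \<open>N\<^bsub>X\<^esub>(G)\<close> consists of its positions that do not occur any more in
  the complementary induced subgraph, not even as border vertices.
\<close>

definition interior_pos :: "('x, 'p, 's) scheme \<Rightarrow> 'x set \<Rightarrow> ('x, 'p, 's) pgraph \<Rightarrow> 'x set" where
  "interior_pos N X G =
     (N X G \<inter> pos ` internal G) - pos ` verts (at_pos G (- N X G))"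

definition private_scheme :: "('x, 'p, 's) rule \<Rightarrow> ('x, 'p, 's) scheme \<Rightarrow> bool" where
  "private_scheme A N \<longleftrightarrow>
     (\<forall>G \<omega> \<omega>'. is_graph G \<and> valid A \<omega> G \<and> valid A \<omega>' G \<and> set \<omega> \<inter> set \<omega>' = {} \<longrightarrow>
        interior_pos N (set \<omega>') G \<inter> N (set \<omega>) G = {})"

definition port_order :: "('p set \<Rightarrow> 'p set \<Rightarrow> bool) \<Rightarrow> bool" where
  "port_order ge \<longleftrightarrow>
     reflp ge \<and> antisymp ge \<and> transp ge \<and>
     (\<forall>A A'. A' \<subseteq> A \<longrightarrow> ge A A') \<and>
     (\<forall>A A' B B'. A \<inter> B = {} \<and> A' \<inter> B' = {} \<and> ge A A' \<and> ge B B' \<and> B \<noteq> B' \<longrightarrow>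
        ge (A \<union> B) (A' \<union> B') \<and> A \<union> B \<noteq> A' \<union> B')"

text \<open>
  The neighbourhood of a vertex of \<open>G\<close>: its state (if it is internal) and its incident
  edges. For internal \<open>u\<close> this is the content of the induced subgraph \<open>G\<^bsub>u\<^esub>\<close>.
\<close>

definition vertex_nbhd ::
    "('x, 'p, 's) pgraph \<Rightarrow> 'x vertex \<Rightarrow> 's option \<times> ('x, 'p) edge set" where
  "vertex_nbhd G u = (state G u, {e \<in> edges G. fst (fst e) = u \<or> fst (snd e) = u})"

text \<open>
  An edge of \<open>G\<close> comes from outside the interior of \<open>N\<^bsub>x\<^esub>(G)\<close> if its source lies outside
  that interior. Every other incoming edge of \<open>u\<close> counts as coming from the interior, in \<open>G\<close> itself
  as well as in its update \<open>H = A\<^bsub>x\<^esub>(G)\<close>; in particular, so does an edge that the update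
  has created between two vertices of \<open>N\<^bsub>x\<^esub>(G)\<close> that are not interior. For \<open>H = G\<close> these are
  exactly the edges whose source is interior.
\<close>

definition outer_edges ::
    "('x, 'p, 's) scheme \<Rightarrow> 'x \<Rightarrow> ('x, 'p, 's) pgraph \<Rightarrow> ('x, 'p) edge set" where
  "outer_edges N x G = {e \<in> edges G. pos (fst (fst e)) \<notin> interior_pos N {x} G}"

definition inner_in_ports ::
    "('x, 'p, 's) scheme \<Rightarrow> 'x \<Rightarrow> ('x, 'p, 's) pgraph \<Rightarrow> ('x, 'p, 's) pgraph \<Rightarrow> 'x vertex \<Rightarrow> 'p set" where
  "inner_in_ports N x G H u = {b. \<exists>w a. ((w, a), (u, b)) \<in> edges H - outer_edges N x G}"

definition port_decreasing :: "('x, 'p, 's) scheme \<Rightarrow> ('x, 'p, 's) rule \<Rightarrow> bool" where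
  "port_decreasing N A \<longleftrightarrow>
     (\<exists>ge. port_order ge \<and>
       (\<forall>G x u. is_graph G \<and> x \<in> pos ` past G \<and> u \<in> verts G \<inter> verts (A x G) \<and>
          vertex_nbhd (A x G) u \<noteq> vertex_nbhd G u \<longrightarrow>
          ge (inner_in_ports N x G G u) (inner_in_ports N x G (A x G) u) \<and>
          inner_in_ports N x G G u \<noteq> inner_in_ports N x G (A x G) u))"

end

theory Submission
  imports Defs
begin

text \<open>
  A position that occurs in two valid words \<open>\<omega>\<close>, \<open>\<omega>'\<close> and is preceded by disjoint prefixes
  \<open>\<alpha>\<close>, \<open>\<beta>\<close> is already in the past of \<open>G\<close>: otherwise both prefixes modify its vertex \<open>u\<close>, and
  by port decrease \<open>\<alpha>\<close> can only do so if \<open>u\<close> has an incoming edge from the interior of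
  \<open>N\<^bsub>\<alpha>\<^esub>(G)\<close>, which \<open>\<beta>\<close> preserves by privacy. Such a position can be commuted to the
  front of both words, so we may assume that \<open>\<omega>\<close> and \<open>\<omega>'\<close> are disjoint. If \<open>\<omega>\<close> then modifies
  an internal vertex \<open>u\<close> of \<open>G\<close>, its ports to the interior of \<open>N\<^bsub>\<omega>\<^esub>(G)\<close> strictly decrease,
  whereas \<open>\<omega>'\<close> keeps all of them, so that \<open>u\<close> has different incoming ports in the two graphs.
  A vertex whose position is not internal in \<open>G\<close> lies outside all neighbourhoods and hence
  coincides with the one in the common continuation of the two graphs.
\<close>

section \<open>Graphs\<close>

lemma is_graph_inj: "is_graph G \<Longrightarrow> u \<in> verts G \<Longrightarrow> v \<in> verts G \<Longrightarrow> pos u = pos v \<Longrightarrow> u = v"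
  unfolding is_graph_def by (meson inj_onD)

lemma internal_verts: "v \<in> internal G \<Longrightarrow> v \<in> verts G"
  by (simp add: verts_def)

lemma past_verts: "v \<in> past G \<Longrightarrow> v \<in> verts G"
  by (simp add: past_def verts_def)

lemma edge_verts:
  assumes "((u, a), (v, b)) \<in> edges G"
  shows "u \<in> verts G" "v \<in> verts G"
proof -
  have "(u, v) \<in> arcs G" using assms by (auto simp: arcs_def)
  then show "u \<in> verts G" "v \<in> verts G" by (auto simp: verts_def Field_def)
qed

lemma internal_induced: "internal (induced G U) = internal G \<inter> U"
  by (auto simp: internal_def induced_def)

lemma edges_induced:
  "((u, a), (v, b)) \<in> edges (induced G U) \<longleftrightarrow>
     ((u, a), (v, b)) \<in> edges G \<and> (u \<in> internal G \<inter> U \<or> v \<in> internal G \<inter> U)"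
  by (simp add: induced_def del: split_paired_Ex)

lemma pgraph_eqI:
  fixes G H :: "('x, 'p, 's) pgraph"
  assumes "\<And>u a v b. ((u, a), (v, b)) \<in> edges G \<longleftrightarrow> ((u, a), (v, b)) \<in> edges H"
    and "state G = state H"
  shows "G = H"
proof (rule pgraph.equality)
  have "e \<in> edges G \<longleftrightarrow> e \<in> edges H" for e
    using assms(1)[of "fst (fst e)" "snd (fst e)" "fst (snd e)" "snd (snd e)"] by simp
  then show "edges G = edges H" by blast
qed (simp_all add: assms(2))

lemma verts_iff:
  "v \<in> verts G \<longleftrightarrow> v \<in> internal G \<or>
     (\<exists>w a b. ((v, a), (w, b)) \<in> edges G \<or> ((w, a), (v, b)) \<in> edges G)"
  by (auto simp: verts_def arcs_def Field_def)

lemma verts_induced: "verts (induced G U) \<subseteq> verts G"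
  unfolding verts_iff subset_iff edges_induced internal_induced by blast

lemma verts_disjoint_union: "verts (G \<squnion> H) = verts G \<union> verts H"
  unfolding set_eq_iff Un_iff verts_iff
  by (auto simp: disjoint_union_def internal_def)

lemma reachable_singletonE:
  assumes "p \<in> reachable {x} G"
  obtains u v where "v \<in> internal G" "u \<in> verts G" "pos u = x" "pos v = p" "(u, v) \<in> (arcs G)\<^sup>*"
proof -
  from assms have "\<exists>v. p = pos v \<and> v \<in> internal G \<and>
      (\<exists>u \<in> verts G. pos u \<in> {x} \<and> (u, v) \<in> (arcs G)\<^sup>*)"
    unfolding reachable_def mem_Collect_eq .
  then show ?thesis using that by (metis singletonD)
qed

lemma vertex_nbhd_edge:
  assumes "vertex_nbhd H r = vertex_nbhd G r" "fst (fst e) = r \<or> fst (snd e) = r"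
  shows "e \<in> edges H \<longleftrightarrow> e \<in> edges G"
  using assms unfolding vertex_nbhd_def by blast

lemma vertex_nbhd_internal:
  "vertex_nbhd H r = vertex_nbhd G r \<Longrightarrow> r \<in> internal H \<longleftrightarrow> r \<in> internal G"
  by (simp add: vertex_nbhd_def internal_def domIff)

lemma vertex_nbhd_past:
  assumes "vertex_nbhd H r = vertex_nbhd G r"
  shows "r \<in> past H \<longleftrightarrow> r \<in> past G"
proof -
  have "((w, a), (r, b)) \<in> edges H \<longleftrightarrow> ((w, a), (r, b)) \<in> edges G" for w a b
    by (rule vertex_nbhd_edge[OF assms]) simp
  then show ?thesis
    using vertex_nbhd_internal[OF assms] by (auto simp: past_def arcs_def)
qed

lemma induced_singleton_cong:
  assumes "vertex_nbhd H v = vertex_nbhd G v"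
  shows "induced H {v} = induced G {v}"
proof -
  have "state (induced H {v}) = state (induced G {v})"
    using assms by (auto simp: induced_def vertex_nbhd_def restrict_map_def)
  moreover have "((u, a), (w, b)) \<in> edges (induced H {v}) \<longleftrightarrow> ((u, a), (w, b)) \<in> edges (induced G {v})"
    for u a w b
    using vertex_nbhd_edge[OF assms, of "((u, a), (w, b))"] vertex_nbhd_internal[OF assms]
    by (auto simp: edges_induced)
  ultimately show ?thesis by (intro pgraph_eqI)
qed

text \<open>Takes a set of edges instead of a graph, so that the incoming ports of a vertex can be
  split along a partition of the edges.\<close>

definition entry_ports :: "('x, 'p) edge set \<Rightarrow> 'x vertex \<Rightarrow> 'p set" where
  "entry_ports E u = {b. \<exists>w a. ((w, a), (u, b)) \<in> E}"

lemma entry_ports_Un: "entry_ports (E \<union> F) u = entry_ports E u \<union> entry_ports F u"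
  by (auto simp: entry_ports_def)

lemma entry_ports_mono: "E \<subseteq> F \<Longrightarrow> entry_ports E u \<subseteq> entry_ports F u"
  by (auto simp: entry_ports_def)

lemma entry_port_unique:
  assumes "is_graph G" "((w, a), (u, b)) \<in> edges G" "((w', a'), (u, b)) \<in> edges G"
  shows "w' = w" "a' = a"
proof -
  have "\<forall>e \<in> edges G. \<forall>f \<in> edges G. {fst e, snd e} \<inter> {fst f, snd f} \<noteq> {} \<longrightarrow> e = f"
    using assms(1) by (simp add: is_graph_def)
  from this[rule_format, OF assms(2,3)] show "w' = w" "a' = a" by auto
qed

text \<open>A port carries at most one edge. This supplies the disjointness that the monotonicity
  clause of \<open>port_order\<close> asks for.\<close>

lemma entry_ports_disjoint:
  assumes "is_graph G" "E \<subseteq> edges G" "F \<subseteq> edges G" "E \<inter> F = {}"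
  shows "entry_ports E u \<inter> entry_ports F u = {}"
proof (rule ccontr)
  assume "entry_ports E u \<inter> entry_ports F u \<noteq> {}"
  then obtain b w a w' a' where e: "((w, a), (u, b)) \<in> E" "((w', a'), (u, b)) \<in> F"
    by (auto simp: entry_ports_def)
  then have "w' = w" "a' = a"
    using entry_port_unique[OF assms(1)] assms(2,3) by blast+
  with e assms(4) show False by blast
qed

lemma inner_in_ports_eq_entry_ports:
  "inner_in_ports N x G H u = entry_ports (edges H - outer_edges N x G) u"
  by (simp add: inner_in_ports_def entry_ports_def)

lemma is_graph_insert_isolated:
  assumes "is_graph G" "z \<notin> pos ` verts G"
  shows "is_graph (G\<lparr>state := (state G)((t, z) \<mapsto> s)\<rparr>)"
proof -
  let ?G = "G\<lparr>state := (state G)((t, z) \<mapsto> s)\<rparr>"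
  have arcs: "arcs ?G = arcs G" by (simp add: arcs_def)
  have internal: "internal ?G = insert (t, z) (internal G)" by (simp add: internal_def)
  have verts: "verts ?G = insert (t, z) (verts G)" by (simp add: verts_def arcs internal)
  have "inj_on pos (verts ?G)"
    using assms by (auto simp: verts is_graph_def)
  then show ?thesis
    using assms(1) by (auto simp: is_graph_def arcs internal)
qed

lemma valid_append: "valid A (\<gamma> @ \<beta>) G \<longleftrightarrow> valid A \<beta> G \<and> valid A \<gamma> (foldr A \<beta> G)"
  by (induction \<gamma>) auto

section \<open>The effect of the rule on neighbourhoods\<close>

locale space_time_rule =
  fixes A :: "('x, 'p, 's) rule"
    and N :: "('x, 'p, 's) scheme"
  assumes scheme: "neighbourhood_scheme N"
    and ext: "extensive N"
    and mon: "monotonous A N"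
    and priv: "private_scheme A N"
    and loc: "local_rule N A"
    and dec: "port_decreasing N A"
    and time_inc: "time_increasing A"
    and comm: "commutative A"
begin

lemma graph_step: "is_graph G \<Longrightarrow> is_graph (A x G)"
  using loc by (auto simp: local_rule_def)

lemma graph_foldr: "is_graph G \<Longrightarrow> is_graph (foldr A \<omega> G)"
  by (induction \<omega>) (auto intro: graph_step)

lemma step_eq:
  assumes "is_graph G" "x \<in> pos ` past G"
  shows "glueable (A x (at_pos G (N {x} G))) (at_pos G (- N {x} G))"
    and "A x G = A x (at_pos G (N {x} G)) \<squnion> at_pos G (- N {x} G)"
  using loc assms unfolding local_rule_def by blast+

lemma N_subset_internal: "is_graph G \<Longrightarrow> N X G \<subseteq> pos ` internal G"
  using scheme unfolding neighbourhood_scheme_def reachable_def by blast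

lemma N_step_subset:
  assumes "is_graph G" "valid A (\<gamma> @ x # \<beta>) G"
  shows "N {x} (foldr A \<beta> G) \<subseteq> N (set (\<gamma> @ x # \<beta>)) G"
  using mon[unfolded monotonous_def, rule_format, of G \<gamma> "[x]" \<beta>] assms by simp

text \<open>\<open>r\<close> is internal in the untouched half \<open>R\<close> of the update, and
  gluing forces every edge of the other half at \<open>r\<close> to occur in \<open>R\<close> too,
  so that the update adds nothing at \<open>r\<close>.\<close>

lemma nbhd_step_outside:
  assumes G: "is_graph G" and x: "x \<in> pos ` past G"
    and r: "r \<in> internal G" "pos r \<notin> N {x} G"
  shows "vertex_nbhd (A x G) r = vertex_nbhd G r"
proof -
  define L where "L = A x (at_pos G (N {x} G))"
  define R where "R = at_pos G (- N {x} G)"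
  have glue: "glueable L R" and AG: "A x G = L \<squnion> R"
    using step_eq[OF G x] by (simp_all add: L_def R_def)
  have rR: "r \<in> internal R"
    using r by (simp add: R_def at_pos_def internal_induced)
  have "state (A x G) r = state R r"
    using rR by (auto simp: AG disjoint_union_def internal_def map_add_def)
  also have "\<dots> = state G r"
    using r by (simp add: R_def at_pos_def induced_def)
  finally have st: "state (A x G) r = state G r" .
  have "((u, a), (v, b)) \<in> edges (A x G) \<longleftrightarrow> ((u, a), (v, b)) \<in> edges G"
    if uv: "u = r \<or> v = r" for u a v b
  proof -
    have "((u, a), (v, b)) \<in> edges L \<Longrightarrow> ((u, a), (v, b)) \<in> edges R"
      using glue rR uv unfolding glueable_def by blast
    moreover have "((u, a), (v, b)) \<in> edges R \<longleftrightarrow> ((u, a), (v, b)) \<in> edges G"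
      using r uv unfolding R_def at_pos_def edges_induced by blast
    ultimately show ?thesis by (auto simp: AG disjoint_union_def)
  qed
  then have "{e \<in> edges (A x G). fst (fst e) = r \<or> fst (snd e) = r}
      = {e \<in> edges G. fst (fst e) = r \<or> fst (snd e) = r}" by auto
  with st show ?thesis by (simp add: vertex_nbhd_def)
qed

text \<open>Monotonicity bounds the neighbourhood of each single step by that of the whole word. The
  word \<open>\<gamma> @ \<beta>\<close> stays fixed while letters move from \<open>\<gamma>\<close>
  to \<open>\<beta>\<close>, so one bound serves the entire induction.\<close>

lemma nbhd_suffix_outside:
  assumes G: "is_graph G" and v: "valid A (\<gamma> @ \<beta>) G"
    and r: "r \<in> internal G" "pos r \<notin> N (set (\<gamma> @ \<beta>)) G"
  shows "vertex_nbhd (foldr A \<beta> G) r = vertex_nbhd G r"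
  using v r(2)
proof (induction \<beta> arbitrary: \<gamma>)
  case Nil
  then show ?case by simp
next
  case (Cons x \<beta>)
  have IH: "vertex_nbhd (foldr A \<beta> G) r = vertex_nbhd G r"
    using Cons.IH[of "\<gamma> @ [x]"] Cons.prems by simp
  have "pos r \<notin> N {x} (foldr A \<beta> G)"
    using N_step_subset[OF G Cons.prems(1)] Cons.prems(2) by blast
  moreover have "x \<in> pos ` past (foldr A \<beta> G)"
    using Cons.prems(1) by (simp add: valid_append)
  moreover have "r \<in> internal (foldr A \<beta> G)"
    using vertex_nbhd_internal[OF IH] r(1) by simp
  ultimately show ?case
    using nbhd_step_outside[OF graph_foldr[OF G], of x \<beta> r] IH by simp
qed

lemma nbhd_outside:
  assumes "is_graph G" "valid A \<omega> G" "r \<in> internal G" "pos r \<notin> N (set \<omega>) G"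
  shows "vertex_nbhd (foldr A \<omega> G) r = vertex_nbhd G r"
  using nbhd_suffix_outside[of G "[]" \<omega> r] assms by simp

text \<open>Contrapositive: a position of the large neighbourhood that is not interior is joined by
  an edge to a vertex outside. That vertex keeps its edges up to the intermediate graph and is
  outside the smaller neighbourhood as well, so the position is not interior there either.\<close>

lemma interior_step_subset:
  assumes G: "is_graph G" and v: "valid A (\<gamma> @ x # \<beta>) G"
  shows "interior_pos N {x} (foldr A \<beta> G) \<subseteq> interior_pos N (set (\<gamma> @ x # \<beta>)) G"
proof
  fix p assume p: "p \<in> interior_pos N {x} (foldr A \<beta> G)"
  let ?M = "N (set (\<gamma> @ x # \<beta>)) G" and ?G = "foldr A \<beta> G"
  have sub: "N {x} ?G \<subseteq> ?M" by (rule N_step_subset[OF G v])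
  have pM: "p \<in> ?M" using p sub by (auto simp: interior_pos_def)
  have "p \<notin> pos ` verts (at_pos G (- ?M))"
  proof
    assume "p \<in> pos ` verts (at_pos G (- ?M))"
    then obtain s where s: "s \<in> verts (at_pos G (- ?M))" "pos s = p" by blast
    have keep: "e \<in> edges ?G \<and> r \<in> internal ?G \<and> pos r \<notin> N {x} ?G"
      if "e \<in> edges G" "r \<in> internal G" "pos r \<notin> ?M" "fst (fst e) = r \<or> fst (snd e) = r" for e r
    proof -
      have nb: "vertex_nbhd ?G r = vertex_nbhd G r"
        using nbhd_suffix_outside[OF G, of "\<gamma> @ [x]" \<beta> r] v that by simp
      show ?thesis
        using vertex_nbhd_edge[OF nb that(4)] vertex_nbhd_internal[OF nb] that sub by blast
    qed
    \<comment> \<open>Since \<open>pos s\<close> lies in \<open>?M\<close>, \<open>s\<close> is not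
      internal in the complement and can only occur there as a border vertex.\<close>
    obtain w a b where "((s, a), (w, b)) \<in> edges (at_pos G (- ?M)) \<or>
        ((w, a), (s, b)) \<in> edges (at_pos G (- ?M))"
      using s pM by (auto simp: verts_iff at_pos_def internal_induced)
    then have "((s, a), (w, b)) \<in> edges G \<and> w \<in> internal G \<and> pos w \<notin> ?M \<or>
        ((w, a), (s, b)) \<in> edges G \<and> w \<in> internal G \<and> pos w \<notin> ?M"
      using s(2) pM unfolding at_pos_def edges_induced by auto
    then have "((s, a), (w, b)) \<in> edges (at_pos ?G (- N {x} ?G)) \<or>
        ((w, a), (s, b)) \<in> edges (at_pos ?G (- N {x} ?G))"
      using keep[of "((s, a), (w, b))" w] keep[of "((w, a), (s, b))" w]
      unfolding at_pos_def edges_induced by auto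
    then have "s \<in> verts (at_pos ?G (- N {x} ?G))"
      using edge_verts by metis
    then show False using p s(2) by (auto simp: interior_pos_def)
  qed
  then show "p \<in> interior_pos N (set (\<gamma> @ x # \<beta>)) G"
    using pM N_subset_internal[OF G] by (auto simp: interior_pos_def)
qed

text \<open>
  If the update created a vertex at a new position, then it would also do so in the presence of
  an isolated vertex at that position, which is not in the neighbourhood of the updated one.
\<close>

lemma positions_step:
  assumes G: "is_graph G" and x: "x \<in> pos ` past G"
  shows "pos ` verts (A x G) \<subseteq> pos ` verts G"
proof (rule ccontr)
  assume "\<not> ?thesis"
  then obtain w where w: "w \<in> verts (A x G)" "pos w \<notin> pos ` verts G" by blast
  \<comment> \<open>The increment gives \<open>n\<close> the position of \<open>w\<close> under a
    different name, so no graph can contain both.\<close>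
  define n where "n = (time w + 1, pos w)"
  define G' where "G' = G\<lparr>state := (state G)(n \<mapsto> undefined)\<rparr>"
  have G': "is_graph G'"
    unfolding G'_def n_def by (rule is_graph_insert_isolated[OF G w(2)])
  have edges: "edges G' = edges G" by (simp add: G'_def)
  have arcs: "arcs G' = arcs G" by (simp add: G'_def arcs_def)
  have internal: "internal G' = insert n (internal G)" by (simp add: G'_def internal_def)
  have verts: "verts G' = insert n (verts G)" by (simp add: verts_def arcs internal)
  have n_pos: "pos n = pos w" by (simp add: n_def)
  have n_new: "n \<notin> verts G" using w(2) n_pos by (metis imageI)
  obtain y where y: "y \<in> past G" "pos y = x" using x by blast
  have yV: "y \<in> verts G" by (rule past_verts[OF y(1)])
  have x': "x \<in> pos ` past G'"
    using y by (auto simp: past_def internal arcs)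
  \<comment> \<open>An isolated vertex is reachable only from itself, and \<open>n\<close> is not
    the past vertex at \<open>x\<close>.\<close>
  have wN: "pos w \<notin> N {x} G'"
  proof
    assume "pos w \<in> N {x} G'"
    then have "pos w \<in> reachable {x} G'"
      using scheme G' by (auto simp: neighbourhood_scheme_def)
    then obtain u v where v: "v \<in> internal G'" "u \<in> verts G'" "pos u = x" "pos v = pos w"
      "(u, v) \<in> (arcs G')\<^sup>*"
      by (rule reachable_singletonE)
    have "v = n"
      using is_graph_inj[OF G' internal_verts[OF v(1)], of n] v(4) n_pos verts by simp
    moreover have "u = y"
      using is_graph_inj[OF G' v(2), of y] v(3) y(2) yV verts by simp
    moreover have "n \<noteq> y" using n_new yV by blast
    ultimately have "n \<in> Range (arcs G)"
      using v(5) by (metis Range.intros arcs rtranclE)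
    then show False using n_new by (auto simp: verts_def Field_def)
  qed
  have edge_internal: "u \<in> internal G \<or> v \<in> internal G" if "((u, a), (v, b)) \<in> edges G" for u a v b
  proof -
    have "\<forall>(u, v) \<in> arcs G. u \<in> internal G \<or> v \<in> internal G"
      using G unfolding is_graph_def by blast
    moreover have "(u, v) \<in> arcs G" using that unfolding arcs_def by blast
    ultimately show ?thesis by (metis (mono_tags, lifting) case_prodD)
  qed
  have n_edge: "u \<noteq> n \<and> v \<noteq> n" if "((u, a), (v, b)) \<in> edges G" for u a v b
    using edge_verts[OF that] n_new by blast
  have "G = induced G' (internal G)"
  proof (rule pgraph_eqI)
    fix u a v b
    show "((u, a), (v, b)) \<in> edges G \<longleftrightarrow> ((u, a), (v, b)) \<in> edges (induced G' (internal G))"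
      using edge_internal unfolding edges_induced edges internal by blast
  next
    show "state G = state (induced G' (internal G))"
      using n_new internal_verts[of n G]
      by (auto simp: G'_def induced_def restrict_map_def internal_def fun_eq_iff dom_def)
  qed
  then have sub: "G \<sqsubseteq> G'" unfolding induced_subgraph_def by blast
  have at_pos_eq: "at_pos G' X = at_pos G X" if "pos w \<notin> X" for X
  proof (rule pgraph_eqI)
    fix u a v b
    show "((u, a), (v, b)) \<in> edges (at_pos G' X) \<longleftrightarrow> ((u, a), (v, b)) \<in> edges (at_pos G X)"
      using n_edge unfolding at_pos_def edges_induced edges internal by blast
  next
    show "state (at_pos G' X) = state (at_pos G X)"
      using that by (auto simp: at_pos_def induced_def G'_def n_def restrict_map_def fun_eq_iff)
  qed
  \<comment> \<open>\<open>G\<close> now lies between \<open>G'\<close> and the restriction of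
    \<open>G'\<close> to its neighbourhood, so extensivity gives both graphs the same neighbourhood
    of \<open>x\<close>.\<close>
  have "at_pos G' (N {x} G') \<sqsubseteq> G"
    unfolding at_pos_eq[OF wN] unfolding induced_subgraph_def at_pos_def by blast
  then have N: "N {x} G' = N {x} G"
    using ext G G' sub unfolding extensive_def by blast
  have "w \<notin> verts (at_pos G (- N {x} G))"
    using verts_induced w(2) unfolding at_pos_def by blast
  \<comment> \<open>The untouched half does not contain \<open>w\<close>, so \<open>w\<close> stems
    from the updated half, which is the same for \<open>G\<close> and \<open>G'\<close>.\<close>
  then have "w \<in> verts (A x (at_pos G (N {x} G)))"
    using w(1) step_eq(2)[OF G x] verts_disjoint_union by (metis UnE)
  moreover have AG': "A x G' = A x (at_pos G (N {x} G)) \<squnion> at_pos G' (- N {x} G)"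
    using step_eq(2)[OF G' x'] at_pos_eq[OF wN] by (simp add: N)
  ultimately have "w \<in> verts (A x G')"
    by (simp add: verts_disjoint_union)
  moreover have "n \<in> internal (at_pos G' (- N {x} G))"
    using wN by (simp add: N at_pos_def internal_induced internal n_pos)
  then have "n \<in> verts (A x G')"
    by (simp add: AG' verts_disjoint_union internal_verts)
  ultimately have "w = n"
    using is_graph_inj[OF graph_step[OF G']] n_pos by metis
  then show False by (metis n_def add_cancel_left_right fst_conv zero_neq_one)
qed

section \<open>Positions and time tags along a valid word\<close>

lemma positions_foldr:
  assumes "is_graph G" "valid A \<omega> G"
  shows "pos ` verts (foldr A \<omega> G) \<subseteq> pos ` verts G"
  using assms(2)
proof (induction \<omega>)
  case (Cons x \<omega>)
  then show ?case
    using positions_step[OF graph_foldr[OF assms(1)], of x \<omega>] by auto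
qed simp

text \<open>Time tags are only compared at positions present before and after a step. As no step
  creates positions, that of \<open>w\<close> occurs in every earlier graph and the inequalities
  chain.\<close>

lemma time_foldr:
  assumes "is_graph G" "valid A \<omega> G" "u \<in> verts G" "w \<in> verts (foldr A \<omega> G)" "pos u = pos w"
  shows "time u \<le> time w"
  using assms(2,4,5)
proof (induction \<omega> arbitrary: w)
  case Nil
  then show ?case using is_graph_inj[OF assms(1,3)] by auto
next
  case (Cons x \<omega>)
  let ?G = "foldr A \<omega> G"
  have x: "x \<in> pos ` past ?G" and v: "valid A \<omega> G" using Cons.prems by auto
  have G: "is_graph ?G" by (rule graph_foldr[OF assms(1)])
  have "pos w \<in> pos ` verts ?G"
    using positions_step[OF G x] Cons.prems(2) by auto
  then obtain w' where w': "w' \<in> verts ?G" "pos w' = pos w" by (metis imageE)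
  have "time u \<le> time w'"
    using Cons.IH[OF v w'(1)] Cons.prems(3) w'(2) by simp
  also have "time w' \<le> time w"
    using time_inc[unfolded time_increasing_def] G x w' Cons.prems(2) by auto
  finally show ?case .
qed

text \<open>The position of \<open>u\<close> occurs in the intermediate graph, and its time tag
  there is squeezed between two copies of \<open>time u\<close>.\<close>

lemma verts_between:
  assumes G: "is_graph G" and v: "valid A (\<gamma> @ \<beta>) G"
    and u: "u \<in> verts G" "u \<in> verts (foldr A (\<gamma> @ \<beta>) G)"
  shows "u \<in> verts (foldr A \<beta> G)"
proof -
  let ?G = "foldr A \<beta> G"
  have v1: "valid A \<beta> G" and v2: "valid A \<gamma> ?G" using v by (auto simp: valid_append)
  have u2: "u \<in> verts (foldr A \<gamma> ?G)" using u(2) by simp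
  have "pos u \<in> pos ` verts ?G"
    using positions_foldr[OF graph_foldr[OF G] v2] u2 by blast
  then obtain w where w: "w \<in> verts ?G" "pos w = pos u" by (metis imageE)
  have "time u \<le> time w" using time_foldr[OF G v1 u(1) w(1)] w(2) by simp
  moreover have "time w \<le> time u" using time_foldr[OF graph_foldr[OF G] v2 w(1) u2 w(2)] .
  ultimately have "u = w" using w(2) by (simp add: prod_eq_iff)
  with w show ?thesis by simp
qed

section \<open>Decrease of ports\<close>

text \<open>Such a vertex occurs in the untouched half of the update, possibly only as a border
  vertex.\<close>

lemma verts_step_notin_interior:
  assumes G: "is_graph G" and x: "x \<in> pos ` past G"
    and u: "u \<in> internal G" "pos u \<notin> interior_pos N {x} G"
  shows "u \<in> verts (A x G)"
proof -
  have "u \<in> verts (at_pos G (- N {x} G))"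
  proof (cases "pos u \<in> N {x} G")
    case True
    then obtain w where "w \<in> verts (at_pos G (- N {x} G))" "pos w = pos u"
      using u by (fastforce simp: interior_pos_def)
    then show ?thesis
      using is_graph_inj[OF G] verts_induced internal_verts[OF u(1)]
      by (metis at_pos_def subsetD)
  next
    case False
    then show ?thesis
      using u by (simp add: at_pos_def internal_verts internal_induced)
  qed
  then show ?thesis
    using step_eq(2)[OF G x] verts_disjoint_union by (metis UnI2)
qed

lemma port_order_decreasing:
  obtains ge where "port_order ge"
    and "\<And>G x u. is_graph G \<Longrightarrow> x \<in> pos ` past G \<Longrightarrow> u \<in> verts G \<Longrightarrow> u \<in> verts (A x G) \<Longrightarrow>
      vertex_nbhd (A x G) u \<noteq> vertex_nbhd G u \<Longrightarrow>
      ge (inner_in_ports N x G G u) (inner_in_ports N x G (A x G) u) \<and>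
      inner_in_ports N x G G u \<noteq> inner_in_ports N x G (A x G) u"
proof -
  from dec[unfolded port_decreasing_def] obtain ge where ge: "port_order ge \<and>
    (\<forall>G x u. is_graph G \<and> x \<in> pos ` past G \<and> u \<in> verts G \<inter> verts (A x G) \<and>
      vertex_nbhd (A x G) u \<noteq> vertex_nbhd G u \<longrightarrow>
      ge (inner_in_ports N x G G u) (inner_in_ports N x G (A x G) u) \<and>
      inner_in_ports N x G G u \<noteq> inner_in_ports N x G (A x G) u)" ..
  show ?thesis
    by (rule that[OF ge[THEN conjunct1]], rule ge[THEN conjunct2, rule_format]) (intro conjI IntI)
qed

text \<open>Inclusivity puts the empty set below every set, so by antisymmetry nothing is strictly
  below it.\<close>

lemma port_order_strict_nonempty:
  assumes "port_order ge" "ge B B'" "B \<noteq> B'"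
  shows "B \<noteq> {}"
  using assms unfolding port_order_def antisymp_def by blast

text \<open>Some update alters \<open>u\<close> while its neighbourhood still is that of
  \<open>G\<close>. Either \<open>u\<close> is interior for this update, or it survives as a vertex;
  then port decrease requires an incoming edge with interior source, and this is an edge of
  \<open>G\<close>.\<close>

lemma nbhd_changed:
  assumes G: "is_graph G" and v: "valid A \<omega> G" and u: "u \<in> internal G"
    and ch: "vertex_nbhd (foldr A \<omega> G) u \<noteq> vertex_nbhd G u"
  shows "pos u \<in> interior_pos N (set \<omega>) G \<or>
    (\<exists>s a b. ((s, a), (u, b)) \<in> edges G \<and> pos s \<in> interior_pos N (set \<omega>) G)"
proof -
  have "vertex_nbhd (foldr A \<beta> G) u \<noteq> vertex_nbhd G u \<Longrightarrow> \<omega> = \<gamma> @ \<beta> \<Longrightarrow> ?thesis" for \<beta> \<gamma>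
  proof (induction \<beta> arbitrary: \<gamma>)
    case Nil
    then show ?case by simp
  next
    case (Cons x \<beta>)
    let ?G = "foldr A \<beta> G"
    show ?case
    proof (cases "vertex_nbhd ?G u = vertex_nbhd G u")
      case False
      then show ?thesis using Cons.IH[of "\<gamma> @ [x]"] Cons.prems(2) by simp
    next
      case True
      have vv: "valid A (\<gamma> @ x # \<beta>) G" using v Cons.prems(2) by simp
      have x: "x \<in> pos ` past ?G" using vv by (simp add: valid_append)
      have G1: "is_graph ?G" by (rule graph_foldr[OF G])
      have int: "interior_pos N {x} ?G \<subseteq> interior_pos N (set \<omega>) G"
        using interior_step_subset[OF G vv] Cons.prems(2) by simp
      have u1: "u \<in> internal ?G" using vertex_nbhd_internal[OF True] u by simp
      show ?thesis
      proof (cases "pos u \<in> interior_pos N {x} ?G")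
        case True
        then show ?thesis using int by blast
      next
        case False
        have u2: "u \<in> verts (A x ?G)" by (rule verts_step_notin_interior[OF G1 x u1 False])
        have "vertex_nbhd (A x ?G) u \<noteq> vertex_nbhd ?G u" using Cons.prems(1) True by simp
        then obtain ge :: "'p set \<Rightarrow> 'p set \<Rightarrow> bool" where "port_order ge"
          "ge (inner_in_ports N x ?G ?G u) (inner_in_ports N x ?G (A x ?G) u)"
          "inner_in_ports N x ?G ?G u \<noteq> inner_in_ports N x ?G (A x ?G) u"
          using port_order_decreasing G1 x u2 internal_verts[OF u1] by metis
        then have "inner_in_ports N x ?G ?G u \<noteq> {}"
          by (rule port_order_strict_nonempty)
        then obtain s a b where e: "((s, a), (u, b)) \<in> edges ?G" "pos s \<in> interior_pos N {x} ?G"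
          by (auto simp: inner_in_ports_def outer_edges_def)
        have "((s, a), (u, b)) \<in> edges G"
          using vertex_nbhd_edge[OF True, of "((s, a), (u, b))"] e(1) by simp
        then show ?thesis using e(2) int by blast
      qed
    qed
  qed
  from this[OF ch, of "[]"] show ?thesis by simp
qed

text \<open>Outside \<open>D\<close>, the ports split into those of outer edges, which the update
  can only lose, and those of inner edges, which strictly decrease. Monotonicity of the order
  combines the two.\<close>

lemma entry_ports_decrease_step:
  assumes ord: "port_order ge"
    and G: "is_graph G" and x: "x \<in> pos ` past G"
    and D: "\<And>e. e \<in> edges G \<Longrightarrow> e \<in> D \<Longrightarrow> pos (fst (fst e)) \<notin> interior_pos N {x} G"
    and B: "ge (inner_in_ports N x G G u) (inner_in_ports N x G (A x G) u)"
      "inner_in_ports N x G G u \<noteq> inner_in_ports N x G (A x G) u"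
  shows "ge (entry_ports (edges G - D) u) (entry_ports (edges (A x G) - D) u) \<and>
    entry_ports (edges G - D) u \<noteq> entry_ports (edges (A x G) - D) u"
proof -
  define O' where "O' = outer_edges N x G"
  let ?B = "entry_ports (edges G - O') u"
  let ?B' = "entry_ports (edges (A x G) - O') u"
  \<comment> \<open>The update may create edges that belong to \<open>D\<close>, so \<open>D\<close>
    is removed from its inner edges; the inner edges of \<open>G\<close> avoid \<open>D\<close>
    already.\<close>
  let ?B'' = "entry_ports (edges (A x G) - O' - D) u"
  let ?C = "entry_ports (O' - D) u"
  let ?C' = "entry_ports (edges (A x G) \<inter> O' - D) u"
  have O': "O' \<subseteq> edges G" by (auto simp: O'_def outer_edges_def)
  have "(edges G - O') \<inter> D = {}" using D by (auto simp: O'_def outer_edges_def)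
  then have "edges G - D = (O' - D) \<union> (edges G - O')" using O' by blast
  then have 1: "entry_ports (edges G - D) u = ?C \<union> ?B" by (simp add: entry_ports_Un)
  have "edges (A x G) - D = (edges (A x G) \<inter> O' - D) \<union> (edges (A x G) - O' - D)" by blast
  then have 2: "entry_ports (edges (A x G) - D) u = ?C' \<union> ?B''" by (metis entry_ports_Un)
  have d1: "?C \<inter> ?B = {}"
    by (rule entry_ports_disjoint[OF G]) (use O' in auto)
  have d2: "?C' \<inter> ?B'' = {}"
    by (rule entry_ports_disjoint[OF graph_step[OF G, of x]]) auto
  have incl: "\<And>X Y. Y \<subseteq> X \<Longrightarrow> ge X Y" and tr: "\<And>X Y Z. ge X Y \<Longrightarrow> ge Y Z \<Longrightarrow> ge X Z"
    and anti: "\<And>X Y. ge X Y \<Longrightarrow> ge Y X \<Longrightarrow> X = Y"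
    using ord unfolding port_order_def by (blast, meson transpD, meson antisympD)
  have B': "ge ?B ?B'" "?B \<noteq> ?B'"
    using B by (simp_all add: inner_in_ports_eq_entry_ports O'_def)
  have B'_B'': "ge ?B' ?B''" by (intro incl entry_ports_mono) auto
  have "?B \<noteq> ?B''" using anti[OF B'(1)] B'(2) B'_B'' by metis
  with tr[OF B'(1) B'_B''] have B'': "ge ?B ?B''" "?B \<noteq> ?B''" .
  have union: "\<And>X X' Y Y'. X \<inter> Y = {} \<Longrightarrow> X' \<inter> Y' = {} \<Longrightarrow> ge X X' \<Longrightarrow> ge Y Y' \<Longrightarrow> Y \<noteq> Y' \<Longrightarrow>
      ge (X \<union> Y) (X' \<union> Y') \<and> X \<union> Y \<noteq> X' \<union> Y'"
    using ord unfolding port_order_def by metis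
  have C: "ge ?C ?C'" by (intro incl entry_ports_mono) auto
  show ?thesis
    unfolding 1 2 by (rule union[OF d1 d2 C B''])
qed

text \<open>\<open>D\<close> is fixed by the whole word, whose interior contains that of each step,
  so every step that alters \<open>u\<close> strictly decreases its ports outside \<open>D\<close>.
  An inclusion at the end would reverse the order.\<close>

lemma inner_entry_ports_not_kept:
  fixes G :: "('x, 'p, 's) pgraph" and u :: "'x vertex" and \<omega> :: "'x list"
  defines "D \<equiv> {e \<in> edges G. pos (fst (fst e)) \<notin> interior_pos N (set \<omega>) G}"
  assumes G: "is_graph G" and v: "valid A \<omega> G"
    and u: "u \<in> verts G" "u \<in> verts (foldr A \<omega> G)"
    and ch: "vertex_nbhd (foldr A \<omega> G) u \<noteq> vertex_nbhd G u"
  shows "\<not> entry_ports (edges G - D) u \<subseteq> entry_ports (edges (foldr A \<omega> G) - D) u"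
proof -
  obtain ge where ord: "port_order ge" and
    dec': "\<And>G x u. is_graph G \<Longrightarrow> x \<in> pos ` past G \<Longrightarrow> u \<in> verts G \<Longrightarrow> u \<in> verts (A x G) \<Longrightarrow>
      vertex_nbhd (A x G) u \<noteq> vertex_nbhd G u \<Longrightarrow>
      ge (inner_in_ports N x G G u) (inner_in_ports N x G (A x G) u) \<and>
      inner_in_ports N x G G u \<noteq> inner_in_ports N x G (A x G) u"
    using port_order_decreasing by blast
  have incl: "\<And>X Y. Y \<subseteq> X \<Longrightarrow> ge X Y" and tr: "\<And>X Y Z. ge X Y \<Longrightarrow> ge Y Z \<Longrightarrow> ge X Z"
    and anti: "\<And>X Y. ge X Y \<Longrightarrow> ge Y X \<Longrightarrow> X = Y"
    using ord unfolding port_order_def by (blast, meson transpD, meson antisympD)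
  let ?Q = "\<lambda>H. entry_ports (edges H - D) u"
  have "\<omega> = \<gamma> @ \<beta> \<Longrightarrow> ge (?Q G) (?Q (foldr A \<beta> G)) \<and>
    (vertex_nbhd (foldr A \<beta> G) u \<noteq> vertex_nbhd G u \<longrightarrow> ?Q G \<noteq> ?Q (foldr A \<beta> G))" for \<beta> \<gamma>
  proof (induction \<beta> arbitrary: \<gamma>)
    case Nil
    then show ?case by (simp add: incl)
  next
    case (Cons x \<beta>)
    let ?G = "foldr A \<beta> G"
    have IH: "ge (?Q G) (?Q ?G)" "vertex_nbhd ?G u \<noteq> vertex_nbhd G u \<Longrightarrow> ?Q G \<noteq> ?Q ?G"
      using Cons.IH[of "\<gamma> @ [x]"] Cons.prems by auto
    have vv: "valid A (\<gamma> @ x # \<beta>) G" using v Cons.prems by simp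
    have x: "x \<in> pos ` past ?G" using vv by (simp add: valid_append)
    have G1: "is_graph ?G" by (rule graph_foldr[OF G])
    show ?case
    proof (cases "vertex_nbhd (A x ?G) u = vertex_nbhd ?G u")
      case True
      have "((w, a), (u, b)) \<in> edges (A x ?G) \<longleftrightarrow> ((w, a), (u, b)) \<in> edges ?G" for w a b
        by (rule vertex_nbhd_edge[OF True]) simp
      then have "?Q (A x ?G) = ?Q ?G" by (auto simp: entry_ports_def)
      then show ?thesis using IH True by simp
    next
      case False
      \<comment> \<open>Port decrease speaks only of vertices present on both sides of the step;
        time tags ensure that \<open>u\<close> never vanishes in between.\<close>
      have "u \<in> verts ?G" "u \<in> verts (A x ?G)"
        using verts_between[OF G, of "\<gamma> @ [x]" \<beta> u] verts_between[OF G, of \<gamma> "x # \<beta>" u]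
          vv u Cons.prems by auto
      then have B: "ge (inner_in_ports N x ?G ?G u) (inner_in_ports N x ?G (A x ?G) u) \<and>
          inner_in_ports N x ?G ?G u \<noteq> inner_in_ports N x ?G (A x ?G) u"
        by (rule dec'[OF G1 x _ _ False])
      have "pos (fst (fst e)) \<notin> interior_pos N {x} ?G" if "e \<in> D" for e
        using that interior_step_subset[OF G vv] Cons.prems by (auto simp: D_def)
      then have st: "ge (?Q ?G) (?Q (A x ?G))" "?Q ?G \<noteq> ?Q (A x ?G)"
        using entry_ports_decrease_step[OF ord G1 x, of D u] B by (blast, blast)
      then have "ge (?Q G) (?Q (A x ?G)) \<and> ?Q G \<noteq> ?Q (A x ?G)"
        using tr[OF IH(1) st(1)] anti[OF st(1)] IH(1) st(2) by metis
      then show ?thesis by simp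
    qed
  qed
  from this[of "[]" \<omega>] ch have "ge (?Q G) (?Q (foldr A \<omega> G))" "?Q G \<noteq> ?Q (foldr A \<omega> G)"
    by simp_all
  then show ?thesis using incl anti by metis
qed

section \<open>Commutation of valid words\<close>

text \<open>A past vertex has no incoming edge, hence is reachable only from itself and lies outside
  the neighbourhood of any other position.\<close>

lemma past_step:
  assumes G: "is_graph G" and x: "x \<in> pos ` past G" and y: "y \<in> pos ` past G" and "x \<noteq> y"
  shows "y \<in> pos ` past (A x G)"
proof -
  obtain q where q: "q \<in> past G" "pos q = y" using y by blast
  have "y \<notin> N {x} G"
  proof
    assume "y \<in> N {x} G"
    then have "y \<in> reachable {x} G"
      using scheme G by (auto simp: neighbourhood_scheme_def)
    then obtain u v where v: "v \<in> internal G" "u \<in> verts G" "pos u = x" "pos v = y"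
      "(u, v) \<in> (arcs G)\<^sup>*"
      by (rule reachable_singletonE)
    have "v = q" using is_graph_inj[OF G] v q internal_verts past_verts by metis
    moreover have "u \<noteq> v" using v \<open>x \<noteq> y\<close> by blast
    ultimately have "q \<in> Range (arcs G)" using v(5) by (metis Range.intros rtranclE)
    then show False using q by (simp add: past_def)
  qed
  then have "vertex_nbhd (A x G) q = vertex_nbhd G q"
    using nbhd_step_outside[OF G x] q by (auto simp: past_def)
  then show ?thesis using vertex_nbhd_past q by blast
qed

lemma past_commute:
  assumes G: "is_graph G" and z: "z \<in> pos ` past G" and v: "valid A \<beta> G" "z \<notin> set \<beta>"
  shows "z \<in> pos ` past (foldr A \<beta> G) \<and> valid A \<beta> (A z G) \<and>
    foldr A \<beta> (A z G) = A z (foldr A \<beta> G)"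
  using v
proof (induction \<beta>)
  case Nil
  then show ?case using z by simp
next
  case (Cons x \<beta>)
  let ?G = "foldr A \<beta> G"
  have IH: "z \<in> pos ` past ?G" "valid A \<beta> (A z G)" "foldr A \<beta> (A z G) = A z ?G"
    using Cons by auto
  have x: "x \<in> pos ` past ?G" "x \<noteq> z" using Cons.prems by auto
  have G1: "is_graph ?G" by (rule graph_foldr[OF G])
  have "z \<in> pos ` past (A x ?G)" "x \<in> pos ` past (A z ?G)"
    using past_step[OF G1] x IH(1) by metis+
  moreover have "A x (A z ?G) = A z (A x ?G)"
    using comm G1 x(1) IH(1) unfolding commutative_def by blast
  ultimately show ?case using IH by simp
qed

text \<open>Closes the diamond: the two graphs have a common continuation.\<close>

lemma disjoint_commute:
  assumes G: "is_graph G" and v: "valid A \<alpha> G" "valid A \<beta> G" "set \<alpha> \<inter> set \<beta> = {}"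
  shows "valid A \<beta> (foldr A \<alpha> G) \<and> foldr A \<beta> (foldr A \<alpha> G) = foldr A \<alpha> (foldr A \<beta> G)"
  using v
proof (induction \<alpha>)
  case (Cons x \<alpha>)
  then show ?case
    using past_commute[OF graph_foldr[OF G], of x \<alpha> \<beta>] by simp
qed simp

lemma past_to_front:
  assumes G: "is_graph G" and z: "z \<in> pos ` past G" and v: "valid A \<omega> G" "z \<in> set \<omega>"
  obtains \<omega>' where "valid A \<omega>' (A z G)" "foldr A \<omega>' (A z G) = foldr A \<omega> G"
    "length \<omega>' < length \<omega>"
proof -
  \<comment> \<open>Words act from right to left, so the last occurrence in the list is the first
    application of \<open>z\<close>.\<close>
  obtain \<gamma> \<beta> where w: "\<omega> = \<gamma> @ z # \<beta>" "z \<notin> set \<beta>" using v(2) by (metis split_list_last)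
  have "valid A \<beta> G" using v(1) w(1) by (simp add: valid_append)
  from past_commute[OF G z this w(2)] show ?thesis
    using that[of "\<gamma> @ \<beta>"] v(1) w(1) by (simp add: valid_append)
qed

section \<open>Consistency\<close>

text \<open>By privacy the source \<open>s\<close> is outside the neighbourhood of
  \<open>\<beta>\<close>, so all edges at \<open>s\<close> survive \<open>\<beta>\<close>.\<close>

lemma interior_edge_kept:
  assumes G: "is_graph G" and v: "valid A \<alpha> G" "valid A \<beta> G" "set \<alpha> \<inter> set \<beta> = {}"
    and e: "((s, a), (u, b)) \<in> edges G" "pos s \<in> interior_pos N (set \<alpha>) G"
  shows "((s, a), (u, b)) \<in> edges (foldr A \<beta> G)"
proof -
  obtain s' where s': "s' \<in> internal G" "pos s' = pos s"
    using e(2) unfolding interior_pos_def by (metis DiffD1 IntD2 imageE)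
  then have "s \<in> internal G"
    using is_graph_inj[OF G] edge_verts(1)[OF e(1)] internal_verts by metis
  moreover have "pos s \<notin> N (set \<beta>) G"
    using priv G v e(2) unfolding private_scheme_def by blast
  ultimately have "vertex_nbhd (foldr A \<beta> G) s = vertex_nbhd G s"
    using nbhd_outside[OF G v(2)] by blast
  from vertex_nbhd_edge[OF this, of "((s, a), (u, b))"] e(1) show ?thesis by simp
qed

text \<open>As \<open>\<beta>\<close> alters \<open>u\<close>, privacy keeps \<open>u\<close> out of
  the interior for \<open>\<alpha>\<close>; thus \<open>u\<close> has an incoming edge from that
  interior, and \<open>\<beta>\<close> keeps it. So after \<open>\<beta>\<close>, \<open>u\<close>
  is still a vertex and is not past.\<close>

lemma both_changed:
  assumes G: "is_graph G" and v: "valid A \<alpha> G" "valid A \<beta> G" "set \<alpha> \<inter> set \<beta> = {}"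
    and u: "u \<in> internal G"
    and ch: "vertex_nbhd (foldr A \<alpha> G) u \<noteq> vertex_nbhd G u"
      "vertex_nbhd (foldr A \<beta> G) u \<noteq> vertex_nbhd G u"
  shows "\<exists>s a b. ((s, a), (u, b)) \<in> edges (foldr A \<beta> G)"
proof -
  have "pos u \<in> N (set \<beta>) G" using nbhd_outside[OF G v(2) u] ch(2) by blast
  then have "pos u \<notin> interior_pos N (set \<alpha>) G"
    using priv G v unfolding private_scheme_def by blast
  then obtain s a b where "((s, a), (u, b)) \<in> edges G" "pos s \<in> interior_pos N (set \<alpha>) G"
    using nbhd_changed[OF G v(1) u ch(1)] by blast
  from interior_edge_kept[OF G v this] show ?thesis by blast
qed

lemma nbhd_unchanged_if_in_ports_subset:
  assumes G: "is_graph G" and v: "valid A \<alpha> G" "valid A \<beta> G" "set \<alpha> \<inter> set \<beta> = {}"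
    and u: "u \<in> verts G" "u \<in> verts (foldr A \<alpha> G)"
    and p: "in_ports (foldr A \<beta> G) u \<subseteq> in_ports (foldr A \<alpha> G) u"
  shows "vertex_nbhd (foldr A \<alpha> G) u = vertex_nbhd G u"
proof (rule ccontr)
  assume ch: "vertex_nbhd (foldr A \<alpha> G) u \<noteq> vertex_nbhd G u"
  define D where "D = {e \<in> edges G. pos (fst (fst e)) \<notin> interior_pos N (set \<alpha>) G}"
  have "entry_ports (edges G - D) u \<subseteq> entry_ports (edges (foldr A \<alpha> G) - D) u"
  proof
    fix b assume "b \<in> entry_ports (edges G - D) u"
    then obtain s a where e: "((s, a), (u, b)) \<in> edges G" "((s, a), (u, b)) \<notin> D"
      by (auto simp: entry_ports_def)
    then have "((s, a), (u, b)) \<in> edges (foldr A \<beta> G)"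
      using interior_edge_kept[OF G v e(1)] by (simp add: D_def)
    then have "b \<in> in_ports (foldr A \<alpha> G) u" using p unfolding in_ports_def by blast
    then obtain s' a' where e': "((s', a'), (u, b)) \<in> edges (foldr A \<alpha> G)"
      by (auto simp: in_ports_def)
    \<comment> \<open>Otherwise it would be an edge of \<open>G\<close> at the port
      \<open>b\<close>, hence the edge from \<open>(s, a)\<close>, which is not in
      \<open>D\<close>.\<close>
    have "((s', a'), (u, b)) \<notin> D"
    proof
      assume D': "((s', a'), (u, b)) \<in> D"
      then have "((s', a'), (u, b)) \<in> edges G" by (simp add: D_def)
      from entry_port_unique[OF G e(1) this] D' e(2) show False by simp
    qed
    with e' show "b \<in> entry_ports (edges (foldr A \<alpha> G) - D) u"
      unfolding entry_ports_def by blast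
  qed
  then show False using inner_entry_ports_not_kept[OF G v(1) u ch] by (simp add: D_def)
qed

lemma consistent_disjoint:
  assumes G: "is_graph G" and v: "valid A \<alpha> G" "valid A \<beta> G" "set \<alpha> \<inter> set \<beta> = {}"
  shows "consistent (foldr A \<alpha> G) (foldr A \<beta> G)"
  unfolding consistent_def
proof (intro ballI impI)
  let ?H = "foldr A \<alpha> G" and ?K = "foldr A \<beta> G"
  fix q assume q: "q \<in> internal ?H \<inter> internal ?K" and p: "in_ports ?H q = in_ports ?K q"
  have v': "set \<beta> \<inter> set \<alpha> = {}" using v(3) by blast
  have q': "q \<in> verts ?H" "q \<in> verts ?K" using q internal_verts by blast+
  have H: "is_graph ?H" "is_graph ?K" by (simp_all add: graph_foldr[OF G])
  have "vertex_nbhd ?H q = vertex_nbhd ?K q"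
  proof (cases "pos q \<in> pos ` internal G")
    case True
    then obtain u where u: "u \<in> internal G" "pos u = pos q" by (metis imageE)
    \<comment> \<open>If \<open>u\<close> were renamed, it would be missing from both graphs, so
      both words would alter it; but then an edge at \<open>u\<close> survives
      \<open>\<beta>\<close>.\<close>
    have "u = q"
    proof (rule ccontr)
      assume "u \<noteq> q"
      then have nu: "u \<notin> verts ?H" "u \<notin> verts ?K"
        using is_graph_inj[OF H(1)] is_graph_inj[OF H(2)] q' u(2) by blast+
      then have "vertex_nbhd ?H u \<noteq> vertex_nbhd G u" "vertex_nbhd ?K u \<noteq> vertex_nbhd G u"
        using vertex_nbhd_internal u(1) internal_verts by blast+
      then show False
        using both_changed[OF G v u(1)] edge_verts(2) nu(2) by metis
    qed
    then have "q \<in> verts G" using u internal_verts by blast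
    \<comment> \<open>Equal incoming ports give both inclusions, so each word leaves
      \<open>q\<close> as it is in \<open>G\<close>.\<close>
    then show ?thesis
      using nbhd_unchanged_if_in_ports_subset[OF G v, of q] nbhd_unchanged_if_in_ports_subset[OF G v(2,1) v', of q] q' p
      by simp
  next
    \<comment> \<open>Neighbourhoods only contain positions that are internal in \<open>G\<close>, so nothing that happens
      between either graph and their common continuation modifies \<open>q\<close>.\<close>
    case False
    have *: "vertex_nbhd (foldr A \<delta> (foldr A \<gamma> G)) q = vertex_nbhd (foldr A \<gamma> G) q"
      if "valid A \<gamma> G" "valid A \<delta> (foldr A \<gamma> G)" "q \<in> internal (foldr A \<gamma> G)" for \<gamma> \<delta>
    proof (rule nbhd_outside[OF graph_foldr[OF G] that(2,3)])
      have "N (set \<delta>) (foldr A \<gamma> G) \<subseteq> N (set (\<delta> @ \<gamma>)) G"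
        using mon[unfolded monotonous_def, rule_format, of G "[]" \<delta> \<gamma>] G that
        by (simp add: valid_append)
      then show "pos q \<notin> N (set \<delta>) (foldr A \<gamma> G)"
        using N_subset_internal[OF G] False by blast
    qed
    have "valid A \<beta> ?H" and eq: "foldr A \<beta> ?H = foldr A \<alpha> ?K"
      using disjoint_commute[OF G v] by blast+
    then have "vertex_nbhd ?H q = vertex_nbhd (foldr A \<beta> ?H) q"
      using *[OF v(1)] q by (metis IntD1)
    also have "valid A \<alpha> ?K" using disjoint_commute[OF G v(2,1) v'] by blast
    then have "vertex_nbhd (foldr A \<beta> ?H) q = vertex_nbhd ?K q"
      using *[OF v(2)] q unfolding eq by (metis IntD2)
    finally show ?thesis .
  qed
  then show "induced ?H {q} = induced ?K {q}" by (rule induced_singleton_cong)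
qed

section \<open>Letters shared by two words\<close>

lemma letter_internal:
  assumes G: "is_graph G" and v: "valid A (z # \<alpha>) G"
  shows "z \<in> pos ` internal G"
proof -
  let ?G = "foldr A \<alpha> G"
  have G1: "is_graph ?G" by (rule graph_foldr[OF G])
  have z: "z \<in> pos ` past ?G" using v by simp
  then obtain q where q: "q \<in> past ?G" "pos q = z" by blast
  \<comment> \<open>Otherwise the past vertex \<open>q\<close> would keep its name, against the
    strict increase of time at \<open>z\<close>.\<close>
  have "z \<in> N {z} ?G"
  proof (rule ccontr)
    assume "z \<notin> N {z} ?G"
    then have "vertex_nbhd (A z ?G) q = vertex_nbhd ?G q"
      using nbhd_step_outside[OF G1 z] q by (auto simp: past_def)
    then have "q \<in> verts (A z ?G)" using vertex_nbhd_past q past_verts by blast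
    then show False
      using time_inc[unfolded time_increasing_def, rule_format, of ?G z q q] G1 z q past_verts[OF q(1)]
      by auto
  qed
  then show ?thesis
    using N_step_subset[OF G, of "[]" z \<alpha>] v N_subset_internal[OF G] by auto
qed

lemma common_letter_past:
  assumes G: "is_graph G" and v: "valid A (z # \<alpha>) G" "valid A (z # \<beta>) G"
    and d: "set \<alpha> \<inter> set \<beta> = {}"
  shows "z \<in> pos ` past G"
proof (rule ccontr)
  assume nz: "z \<notin> pos ` past G"
  have v': "valid A \<alpha> G" "valid A \<beta> G" using v by auto
  obtain u where u: "u \<in> internal G" "pos u = z" using letter_internal[OF G v(1)] by (metis imageE)
  have same: "q = u" if "q \<in> past (foldr A \<gamma> G)" "pos q = z" "u \<in> verts (foldr A \<gamma> G)" for q \<gamma>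
    using is_graph_inj[OF graph_foldr[OF G] past_verts[OF that(1)] that(3)] that(2) u(2) by simp
  \<comment> \<open>If \<open>u\<close> were unchanged, it would be the past vertex at
    \<open>z\<close> after \<open>\<gamma>\<close>, and so already past in \<open>G\<close>.\<close>
  have ch: "vertex_nbhd (foldr A \<gamma> G) u \<noteq> vertex_nbhd G u" if past: "z \<in> pos ` past (foldr A \<gamma> G)" for \<gamma>
  proof
    assume nb: "vertex_nbhd (foldr A \<gamma> G) u = vertex_nbhd G u"
    then have "u \<in> verts (foldr A \<gamma> G)" using vertex_nbhd_internal u(1) internal_verts by blast
    then have "u \<in> past (foldr A \<gamma> G)" using past same by blast
    then show False using vertex_nbhd_past[OF nb] nz u(2) by blast
  qed
  obtain s a b where e: "((s, a), (u, b)) \<in> edges (foldr A \<beta> G)"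
    using both_changed[OF G v' d u(1) ch ch] v by auto
  obtain q where q: "q \<in> past (foldr A \<beta> G)" "pos q = z" using v(2) by auto
  have "q = u" by (rule same[OF q edge_verts(2)[OF e]])
  then show False using q(1) e unfolding past_def arcs_def by blast
qed

lemma common_letter:
  assumes G: "is_graph G" and v: "valid A \<omega> G" "valid A \<omega>' G" and "set \<omega> \<inter> set \<omega>' \<noteq> {}"
  obtains z where "z \<in> pos ` past G" "z \<in> set \<omega>" "z \<in> set \<omega>'"
proof -
  have "\<exists>x \<in> set \<omega>. x \<in> set \<omega>'" using assms(4) by blast
  \<comment> \<open>Taking the rightmost shared letter of \<open>\<omega>\<close> makes the suffix
    \<open>\<alpha>\<close> disjoint from all of \<open>\<omega>'\<close>, so any split of
    \<open>\<omega>'\<close> at \<open>z\<close> will do.\<close>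
  then obtain \<gamma> z \<alpha> where w: "\<omega> = \<gamma> @ z # \<alpha>" "z \<in> set \<omega>'" "\<forall>y \<in> set \<alpha>. y \<notin> set \<omega>'"
    by (rule split_list_last_propE) blast
  then obtain \<gamma>' \<beta> where w': "\<omega>' = \<gamma>' @ z # \<beta>" by (meson split_list)
  have "valid A (z # \<alpha>) G" "valid A (z # \<beta>) G"
    using v w(1) w' by (simp_all add: valid_append)
  moreover have "set \<alpha> \<inter> set \<beta> = {}" using w(3) w' by auto
  ultimately have "z \<in> pos ` past G" by (rule common_letter_past[OF G])
  then show ?thesis using that w(1,2) by simp
qed

text \<open>Performing a shared past letter \<open>z\<close> first turns \<open>G\<close> into
  \<open>A z G\<close> and shortens \<open>\<omega>\<close>; hence the induction on its length with
  arbitrary graph.\<close>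

lemma consistent_valid:
  assumes "is_graph G" "valid A \<omega> G" "valid A \<omega>' G"
  shows "consistent (foldr A \<omega> G) (foldr A \<omega>' G)"
  using assms
proof (induction "length \<omega>" arbitrary: G \<omega> \<omega>' rule: less_induct)
  case less
  show ?case
  proof (cases "set \<omega> \<inter> set \<omega>' = {}")
    case True
    then show ?thesis by (rule consistent_disjoint[OF less.prems])
  next
    case False
    then obtain z where z: "z \<in> pos ` past G" "z \<in> set \<omega>" "z \<in> set \<omega>'"
      using common_letter[OF less.prems] by blast
    obtain \<alpha> where a: "valid A \<alpha> (A z G)" "foldr A \<alpha> (A z G) = foldr A \<omega> G"
      "length \<alpha> < length \<omega>"
      using past_to_front[OF less.prems(1) z(1) less.prems(2) z(2)] by blast
    obtain \<beta> where b: "valid A \<beta> (A z G)" "foldr A \<beta> (A z G) = foldr A \<omega>' G"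
      using past_to_front[OF less.prems(1) z(1) less.prems(3) z(3)] by blast
    show ?thesis
      using less.hyps[OF a(3) graph_step[OF less.prems(1)] a(1) b(1)] a(2) b(2) by simp
  qed
qed

end

theorem mainTheorem1:
  fixes A :: "('x, 'p, 's) rule"
    and N :: "('x, 'p, 's) scheme"
    and G :: "('x, 'p, 's) pgraph"
  assumes "neighbourhood_scheme N"
    and "extensive N"
    and "monotonous A N"
    and "private_scheme A N"
    and "local_rule N A"
    and "port_decreasing N A"
    and "time_increasing A"
    and "commutative A"
    and "is_graph G"
  shows "\<forall>H \<in> space_time A G. \<forall>H' \<in> space_time A G. consistent H H'"
proof -
  interpret space_time_rule A N
    using assms by unfold_locales
  show ?thesis
    using consistent_valid[OF assms(9)] by (auto simp: space_time_def)
qed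

end
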